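(* With the vector fields and functions of the context, let $\bm F_{OA}=\chi\bm F+(1-\chi)\bm\tau^b$, and define two vector fields $\bm G_{OA}$ and $\bm H_{OA}$ by $$\bm G_{OA}=\mu\,\bm G+(1-\mu)\,\bm n,$$ $$\bm H_{OA}=\chi\mu\,\bm H+(1-\chi)(1-\mu)\,\bm\tau^a+\mu(1-\chi)\,\bm G\times\bm\tau^b+\chi(1-\mu)\,\bm n\times\bm F,$$ where $\mu$ is given by $$\mu=\frac{\chi\,\bm F\cdot\bm n}{\chi\,\bm F\cdot\bm n+(\chi-1)\,\bm\tau^b\cdot\bm G}.$$ Then each two of the vector fields $\bm F_{OA},\bm G_{OA},\bm H_{OA}$ are orthogonal.
   Context: Setting. $\bm p=(x,y,z)\in\mathbb{R}^3$. An obstacle centered at $\bm p_o\in\mathbb{R}^3$ is described by a function $\Upsilon(\bm p;\bm p_o)$, real-valued, with continuous first-order derivatives, increasing monotonically with respect to $\|\bm p-\bm p_o\|$, and whose level surfaces enclose a region; the obstacle surface is $\Upsilon=1$, the obstacle area is $\{\Upsilon<1\}$ and the reactive area is $\{1\le\Upsilon\le\bar c\}$, with $\bar c$ a constant. The vector field $\bm F_{OA}$ is the obstacle avoidance vector field in the reactive area. The target point of the robot is the origin, which belongs neither to the obstacle area nor to the reactive area. Vector fields. $\bm F=[x^2-y^2-z^2,\ 2xy,\ 2xz]^{\rm T}$, $\bm G=[2x(y^2+z^2),\ y(y^2+z^2-x^2),\ z(y^2+z^2-x^2)]^{\rm T}$, $\bm H=\bm G\times\bm F$, and $\bm n=\left[\frac{\partial\Upsilon}{\partial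 x}\ \frac{\partial\Upsilon}{\partial y}\ \frac{\partial\Upsilon}{\partial z}\right]^{\rm T}$ is the normal vector of the level surfaces of $\Upsilon$. The vector fields $\bm\tau^a,\bm\tau^b$ are $$\bm\tau^a=\bm n\times\bm F,\quad \bm\tau^b=\bm\tau^a\times\bm n\quad\text{where } \bm n \text{ and } \bm F \text{ are not collinear},$$ $$\bm\tau^a=\bm H,\quad \bm\tau^b=\bm G\quad\text{where } \bm n \text{ and } \bm F \text{ are collinear}.$$ Transition function. $\chi$ is a smooth function of $\bm p$ with $\chi=0$ where $\Upsilon\le 1$, $\chi=1$ where $\Upsilon\ge\bar c$, and values in $(0,1)$ where $1<\Upsilon<\bar c$.
   Formalization: G_OA ⟂ H_OA fails for n = grad Υ of general length; here n is any positive multiple of grad Υ, and this one orthogonality requires |n| = 1 where 1 < Υ < c̄ and n, F are not collinear. The denominator of μ is assumed nonzero at the point. *)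

theory Defs
  imports "HOL-Analysis.Analysis"
begin

unbundle cross3_syntax

definition partial :: "3 \<Rightarrow> (real^3 \<Rightarrow> real) \<Rightarrow> real^3 \<Rightarrow> real" where
  "partial i f p = deriv (\<lambda>t. f (p + t *\<^sub>R axis i 1)) 0"

fun C_k :: "nat \<Rightarrow> (real^3 \<Rightarrow> real) \<Rightarrow> bool" where
  "C_k 0 f \<longleftrightarrow> continuous_on UNIV f"
| "C_k (Suc k) f \<longleftrightarrow> (\<forall>p. f differentiable (at p)) \<and> (\<forall>i. C_k k (partial i f))"

definition smooth :: "(real^3 \<Rightarrow> real) \<Rightarrow> bool" where
  "smooth f \<longleftrightarrow> (\<forall>k. C_k k f)"

definition gradient :: "(real^3 \<Rightarrow> real) \<Rightarrow> real^3 \<Rightarrow> real^3" where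
  "gradient f p = vector [partial 1 f p, partial 2 f p, partial 3 f p]"

text \<open>Here \<open>\<Upsilon>\<close> stands for the function \<open>\<Upsilon>(_; po)\<close> of an obstacle centered at \<open>po\<close>.
  Monotonicity in the distance from \<open>po\<close> is monotonicity along every ray issuing from \<open>po\<close>
  (it is not required that \<open>\<Upsilon>\<close> depends on the distance alone, so level surfaces need not be
  spheres). It is taken in the weak sense, which includes the strict one. The level of \<open>po\<close>
  itself is exempted in the last condition because its level set may be the single point \<open>po\<close>.\<close>

definition obstacle_function :: "(real^3 \<Rightarrow> real) \<Rightarrow> real^3 \<Rightarrow> bool" where
  "obstacle_function \<Upsilon> po \<longleftrightarrow>
     C_k 1 \<Upsilon> \<and>
     (\<forall>u. norm u = 1 \<longrightarrow> mono_on {0..} (\<lambda>t. \<Upsilon> (po + t *\<^sub>R u))) \<and>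
     (\<forall>c \<in> range \<Upsilon>. \<Upsilon> po < c \<longrightarrow> inside {q. \<Upsilon> q = c} \<noteq> {})"

definition obstacle_area :: "(real^3 \<Rightarrow> real) \<Rightarrow> (real^3) set" where
  "obstacle_area \<Upsilon> = {p. \<Upsilon> p < 1}"

definition reactive_area :: "(real^3 \<Rightarrow> real) \<Rightarrow> real \<Rightarrow> (real^3) set" where
  "reactive_area \<Upsilon> cbar = {p. 1 \<le> \<Upsilon> p \<and> \<Upsilon> p \<le> cbar}"

definition transition_function ::
    "(real^3 \<Rightarrow> real) \<Rightarrow> (real^3 \<Rightarrow> real) \<Rightarrow> real \<Rightarrow> bool" where
  "transition_function chi \<Upsilon> cbar \<longleftrightarrow>
     smooth chi \<and>
     (\<forall>p. \<Upsilon> p \<le> 1 \<longrightarrow> chi p = 0) \<and>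
     (\<forall>p. cbar \<le> \<Upsilon> p \<longrightarrow> chi p = 1) \<and>
     (\<forall>p. 1 < \<Upsilon> p \<and> \<Upsilon> p < cbar \<longrightarrow> 0 < chi p \<and> chi p < 1)"

text \<open>A normal vector field of the level surfaces with unspecified length: \<open>n = gradient \<Upsilon>\<close>
  is the case \<open>k = 1\<close>, and \<open>n = (\<lambda>p. sgn (gradient \<Upsilon> p))\<close> is the unit normal (wherever
  the gradient does not vanish).\<close>

definition normal_field :: "(real^3 \<Rightarrow> real^3) \<Rightarrow> (real^3 \<Rightarrow> real) \<Rightarrow> bool" where
  "normal_field n \<Upsilon> \<longleftrightarrow> (\<forall>p. \<exists>k>0. n p = k *\<^sub>R gradient \<Upsilon> p)"

definition F :: "real^3 \<Rightarrow> real^3" where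
  "F p = (let x = p$1; y = p$2; z = p$3 in
     vector [x^2 - y^2 - z^2, 2 * x * y, 2 * x * z])"

definition G :: "real^3 \<Rightarrow> real^3" where
  "G p = (let x = p$1; y = p$2; z = p$3 in
     vector [2 * x * (y^2 + z^2), y * (y^2 + z^2 - x^2), z * (y^2 + z^2 - x^2)])"

definition H :: "real^3 \<Rightarrow> real^3" where
  "H p = G p \<times> F p"

definition tau_a :: "(real^3 \<Rightarrow> real^3) \<Rightarrow> real^3 \<Rightarrow> real^3" where
  "tau_a n p = (if collinear {0, n p, F p} then H p else n p \<times> F p)"

definition tau_b :: "(real^3 \<Rightarrow> real^3) \<Rightarrow> real^3 \<Rightarrow> real^3" where
  "tau_b n p = (if collinear {0, n p, F p} then G p else tau_a n p \<times> n p)"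

definition mu_den :: "(real^3 \<Rightarrow> real) \<Rightarrow> (real^3 \<Rightarrow> real^3) \<Rightarrow> real^3 \<Rightarrow> real" where
  "mu_den chi n p = chi p * (F p \<bullet> n p) + (chi p - 1) * (tau_b n p \<bullet> G p)"

definition mu :: "(real^3 \<Rightarrow> real) \<Rightarrow> (real^3 \<Rightarrow> real^3) \<Rightarrow> real^3 \<Rightarrow> real" where
  "mu chi n p = chi p * (F p \<bullet> n p) / mu_den chi n p"

definition F_OA :: "(real^3 \<Rightarrow> real) \<Rightarrow> (real^3 \<Rightarrow> real^3) \<Rightarrow> real^3 \<Rightarrow> real^3" where
  "F_OA chi n p = chi p *\<^sub>R F p + (1 - chi p) *\<^sub>R tau_b n p"

definition G_OA :: "(real^3 \<Rightarrow> real) \<Rightarrow> (real^3 \<Rightarrow> real^3) \<Rightarrow> real^3 \<Rightarrow> real^3" where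
  "G_OA chi n p = mu chi n p *\<^sub>R G p + (1 - mu chi n p) *\<^sub>R n p"

text \<open>Where \<open>n\<close> and \<open>F\<close> are not collinear, \<open>H_OA\<close> differs from the cross product of \<open>G_OA\<close>
  with \<open>F_OA\<close> by the factor \<open>(norm (n p))\<^sup>2\<close> missing in its second term, because
  \<open>n \<times> tau_b = (norm n)\<^sup>2 *\<^sub>R tau_a\<close>. Orthogonality of \<open>G_OA\<close> and \<open>H_OA\<close> therefore depends on the
  normalization of \<open>n\<close>: there
  \<open>G_OA \<bullet> H_OA = \<mu> * (1 - \<mu>) * (1 - chi) * (1 - (norm n)\<^sup>2) * (G \<bullet> (n \<times> F))\<close>.\<close>

definition H_OA :: "(real^3 \<Rightarrow> real) \<Rightarrow> (real^3 \<Rightarrow> real^3) \<Rightarrow> real^3 \<Rightarrow> real^3" where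
  "H_OA chi n p =
     (chi p * mu chi n p) *\<^sub>R H p
     + ((1 - chi p) * (1 - mu chi n p)) *\<^sub>R tau_a n p
     + (mu chi n p * (1 - chi p)) *\<^sub>R (G p \<times> tau_b n p)
     + (chi p * (1 - mu chi n p)) *\<^sub>R (n p \<times> F p)"

end

theory Submission
  imports Defs
begin

text \<open>Since \<open>F \<bullet> G = 0\<close> and \<open>tau_b \<bullet> n = 0\<close>, the product \<open>F_OA \<bullet> G_OA\<close> reduces to
  \<open>chi (1 - \<mu>) (F \<bullet> n) + (1 - chi) \<mu> (tau_b \<bullet> G)\<close>, which the choice of \<open>\<mu>\<close> makes zero.
  For \<open>H_OA\<close>: where \<open>n\<close> and \<open>F\<close> are not collinear,
  \<open>H_OA = G_OA \<times> F_OA + (1 - chi) (1 - \<mu>) (1 - (norm n)\<^sup>2) tau_a\<close> with \<open>tau_a\<close> orthogonal to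
  \<open>F\<close>, \<open>tau_b\<close> and \<open>n\<close>; the last term vanishes for unit \<open>n\<close>, for \<open>chi = 1\<close>, and is orthogonal
  to \<open>G_OA = n\<close> for \<open>chi = 0\<close>. Where they are collinear, \<open>F\<close> does not vanish off the origin, so
  \<open>n\<close> is a multiple of \<open>F\<close>; then \<open>F_OA\<close> and \<open>G_OA\<close> lie in the span of \<open>F\<close> and \<open>G\<close>, while
  \<open>H_OA\<close> is a multiple of \<open>H = G \<times> F\<close>.\<close>

lemma inner_F_G: "F p \<bullet> G p = 0"
  by (simp add: F_def G_def Let_def inner_vec_def sum_3) algebra

lemma F_eq_0_iff: "F p = 0 \<longleftrightarrow> p = 0"
proof
  assume "F p = 0"
  then have *: "(p$1)\<^sup>2 - (p$2)\<^sup>2 - (p$3)\<^sup>2 = 0" "p$1 * p$2 = 0" "p$1 * p$3 = 0"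
    by (auto simp: F_def Let_def vec_eq_iff forall_3)
  \<comment> \<open>Otherwise the two products force \<open>p$2 = p$3 = 0\<close>, and the first
    equation then gives \<open>p$1 = 0\<close>.\<close>
  have "p$1 = 0"
    using * by auto
  then have "(p$2)\<^sup>2 + (p$3)\<^sup>2 = 0"
    using *(1) by (simp only: power_zero_numeral)
  with \<open>p$1 = 0\<close> show "p = 0"
    by (simp add: vec_eq_iff forall_3 sum_power2_eq_zero_iff)
qed (simp add: F_def Let_def vec_eq_iff forall_3)

lemma normal_multiple_F:
  assumes "collinear {0, n p, F p}" and "p \<noteq> 0"
  obtains c where "n p = c *\<^sub>R F p"
proof -
  \<comment> \<open>With \<open>F p\<close> in the middle, \<open>collinear_lemma\<close> expresses
    \<open>n p\<close> through \<open>F p\<close>; its case \<open>n p = 0\<close> takes the factor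
    0.\<close>
  from assms(1) have "collinear {0, F p, n p}"
    by (simp add: insert_commute)
  with assms(2) show ?thesis
    using that[of 0] that by (auto simp: collinear_lemma F_eq_0_iff)
qed

lemma inner_tau_b_normal:
  assumes "p \<noteq> 0"
  shows "tau_b n p \<bullet> n p = 0"
proof (cases "collinear {0, n p, F p}")
  case True
  then obtain c where "n p = c *\<^sub>R F p"
    using assms by (rule normal_multiple_F)
  with True show ?thesis
    using inner_F_G[of p] by (simp add: tau_b_def inner_commute)
qed (simp add: tau_b_def dot_cross_self)

lemma orthogonal_F_OA_G_OA:
  assumes "p \<noteq> 0" and "mu_den chi n p \<noteq> 0"
  shows "orthogonal (F_OA chi n p) (G_OA chi n p)"
proof -
  define m where "m = mu chi n p"
  have m: "m * (chi p * (F p \<bullet> n p) + (chi p - 1) * (tau_b n p \<bullet> G p)) = chi p * (F p \<bullet> n p)"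
    using assms(2) by (simp add: m_def mu_def flip: mu_den_def)
  have "F_OA chi n p \<bullet> G_OA chi n p
      = chi p * (1 - m) * (F p \<bullet> n p) + (1 - chi p) * m * (tau_b n p \<bullet> G p)"
    using inner_F_G[of p] inner_tau_b_normal[OF assms(1), of n]
    by (simp add: F_OA_def G_OA_def inner_add_left inner_add_right flip: m_def)
  also have "\<dots> = 0"
    using m by (simp add: algebra_simps)
  finally show ?thesis
    by (simp add: orthogonal_def)
qed

text \<open>Here \<open>n p \<times> F p\<close> and \<open>G p \<times> tau_b n p\<close> vanish,
  the latter because \<open>tau_b\<close> is \<open>G\<close>.\<close>

lemma H_OA_collinear:
  assumes "collinear {0, n p, F p}" and "p \<noteq> 0"
  obtains k where "H_OA chi n p = k *\<^sub>R H p"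
proof -
  obtain c where "n p = c *\<^sub>R F p"
    using assms by (rule normal_multiple_F)
  then have "H_OA chi n p
      = (chi p * mu chi n p + (1 - chi p) * (1 - mu chi n p)) *\<^sub>R H p"
    using assms(1) by (simp add: H_OA_def tau_a_def tau_b_def scaleR_add_left cross_mult_left)
  then show ?thesis
    by (rule that)
qed

lemma inner_F_H: "F p \<bullet> H p = 0"
  and inner_G_H: "G p \<bullet> H p = 0"
  by (simp_all add: H_def dot_cross_self)

lemma H_OA_noncollinear:
  assumes "\<not> collinear {0, n p, F p}"
  shows "H_OA chi n p = G_OA chi n p \<times> F_OA chi n p
    + ((1 - chi p) * (1 - mu chi n p) * (1 - (norm (n p))\<^sup>2)) *\<^sub>R (n p \<times> F p)"
proof -
  \<comment> \<open>Expansion of the triple product; its other term vanishes as \<open>n p\<close>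
    is orthogonal to \<open>n p \<times> F p\<close>.\<close>
  have "n p \<times> tau_b n p = (norm (n p))\<^sup>2 *\<^sub>R (n p \<times> F p)"
    using assms
    by (simp add: tau_b_def tau_a_def Lagrange dot_cross_self power2_norm_eq_inner)
  then show ?thesis
    using assms
    by (simp add: H_OA_def G_OA_def F_OA_def H_def tau_a_def cross_add_left cross_add_right
        cross_mult_left cross_mult_right)
      (simp add: algebra_simps)
qed

lemma orthogonal_F_OA_H_OA:
  assumes "p \<noteq> 0"
  shows "orthogonal (F_OA chi n p) (H_OA chi n p)"
proof (cases "collinear {0, n p, F p}")
  case True
  then obtain k where "H_OA chi n p = k *\<^sub>R H p"
    using assms by (rule H_OA_collinear)
  with True show ?thesis
    by (simp add: orthogonal_def F_OA_def tau_b_def inner_add_left inner_F_H inner_G_H)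
next
  case False
  have "F_OA chi n p \<bullet> (n p \<times> F p) = 0"
    using False
    by (simp add: F_OA_def tau_b_def tau_a_def inner_add_left dot_cross_self)
  then show ?thesis
    by (simp add: orthogonal_def H_OA_noncollinear[where n = n, OF False] inner_add_right dot_cross_self)
qed

lemma orthogonal_G_OA_H_OA:
  assumes "p \<noteq> 0"
    and "collinear {0, n p, F p} \<or> chi p = 0 \<or> chi p = 1 \<or> norm (n p) = 1"
  shows "orthogonal (G_OA chi n p) (H_OA chi n p)"
proof (cases "collinear {0, n p, F p}")
  case True
  obtain c where "n p = c *\<^sub>R F p"
    using True assms(1) by (rule normal_multiple_F)
  moreover obtain k where "H_OA chi n p = k *\<^sub>R H p"
    using True assms(1) by (rule H_OA_collinear)
  ultimately show ?thesis
    by (simp add: orthogonal_def G_OA_def inner_add_left inner_F_H inner_G_H)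
next
  case False
  \<comment> \<open>The numerator vanishes, so this holds even for a zero denominator.\<close>
  have "mu chi n p = 0" if "chi p = 0"
    using that by (simp add: mu_def)
  then have "((1 - chi p) * (1 - mu chi n p) * (1 - (norm (n p))\<^sup>2))
      * (G_OA chi n p \<bullet> (n p \<times> F p)) = 0"
    using assms(2) False by (auto simp: G_OA_def dot_cross_self)
  then show ?thesis
    by (simp add: orthogonal_def H_OA_noncollinear[where n = n, OF False] inner_add_right dot_cross_self)
qed

theorem lemma5:
  fixes \<Upsilon> chi :: "real^3 \<Rightarrow> real" and n :: "real^3 \<Rightarrow> real^3"
    and po p :: "real^3" and cbar :: real
  assumes obstacle: "obstacle_function \<Upsilon> po"
    and target: "0 \<notin> obstacle_area \<Upsilon> \<union> reactive_area \<Upsilon> cbar"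
    and transition: "transition_function chi \<Upsilon> cbar"
    and normal: "normal_field n \<Upsilon>"
    and reactive: "p \<in> reactive_area \<Upsilon> cbar"
    and mu_defined: "mu_den chi n p \<noteq> 0"
  shows "orthogonal (F_OA chi n p) (G_OA chi n p)
       \<and> orthogonal (F_OA chi n p) (H_OA chi n p)
       \<and> ((1 < \<Upsilon> p \<and> \<Upsilon> p < cbar \<and> \<not> collinear {0, n p, F p} \<longrightarrow> norm (n p) = 1)
            \<longrightarrow> orthogonal (G_OA chi n p) (H_OA chi n p))"
proof (intro conjI impI)
  have "p \<noteq> 0"
    using target reactive by auto
  then show "orthogonal (F_OA chi n p) (G_OA chi n p)"
    and "orthogonal (F_OA chi n p) (H_OA chi n p)"
    using mu_defined by (simp_all add: orthogonal_F_OA_G_OA orthogonal_F_OA_H_OA)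
  assume unit: "1 < \<Upsilon> p \<and> \<Upsilon> p < cbar \<and> \<not> collinear {0, n p, F p} \<longrightarrow> norm (n p) = 1"
  have "chi p = 0 \<or> chi p = 1 \<or> 1 < \<Upsilon> p \<and> \<Upsilon> p < cbar"
    using transition unfolding transition_function_def by (meson not_le)
  with unit have "collinear {0, n p, F p} \<or> chi p = 0 \<or> chi p = 1 \<or> norm (n p) = 1"
    by blast
  with \<open>p \<noteq> 0\<close> show "orthogonal (G_OA chi n p) (H_OA chi n p)"
    by (rule orthogonal_G_OA_H_OA)
qed

end
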